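(* Let $(\theta_1,\dots,\theta_n)\in\mathbb C^n$ and let $f$ be the rational function $$f(z)=\frac{n(-1)^n\theta_n^pz^{n-1}+(n-1)(-1)^{n-1}\theta_{n-1}z^{n-2}+\cdots+(-\theta_1)}{n-(n-1)\theta_1z+\cdots+(-1)^{n-1}\theta_{n-1}z^{n-1}}.$$ Then the following are equivalent: (1) $(\theta_1,\dots,\theta_n)\in\overline{\mathbf{\Theta}}_n$. (2) $(\theta_1,\dots,\theta_{n-1},\theta_n^p)\in\Gamma_n$. (3) $\sup_{|z|\le1}|f(z)|\le1$. (4) $|\theta_n|\le1$ and there exists $(\alpha_1,\dots,\alpha_{n-1})\in\Gamma_{n-1}$ such that $\theta_i=\alpha_i+\overline{\alpha}_{n-i}\theta_n^p$ for $1\le i\le n-1$.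
   Context: $\mathbb D$ is the open unit disc. Fix positive integers $m,p$ with $p$ dividing $m$, and $n\ge2$. Let $s_i$ denote the $i$-th elementary symmetric polynomial; for $d\ge1$, $\Gamma_d=\{(s_1(z),\dots,s_d(z)):z\in\overline{\mathbb D}^d\}$ is the closed symmetrized polydisc. $\overline{\mathbf{\Theta}}_n$ is the image of $\overline{\mathbb D}^n$ under the map $z\mapsto\big(s_1(z_1^m,\dots,z_n^m),\dots,s_{n-1}(z_1^m,\dots,z_n^m),(z_1\cdots z_n)^{m/p}\big)$. With $\theta_0=1$, the numerator of $f$ is $\sum_{i=1}^{n-1}(-1)^i i\theta_iz^{i-1}+(-1)^n n\theta_n^pz^{n-1}$ and its denominator is $\sum_{i=0}^{n-1}(-1)^i(n-i)\theta_iz^i$. As a rational function $f$ is understood after cancellation of common factors of numerator and denominator, with $|f|=\infty$ at poles. *)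

theory Defs
  imports
    "HOL-Analysis.Analysis"
    "HOL-Computational_Algebra.Computational_Algebra"
    "HOL-Computational_Algebra.Field_as_Ring"
begin

text \<open>
  The dimension varies within the statement, so a point of d-dimensional complex space is an
  extensional function on the index set \<open>{1..d}\<close>, i.e. an element of \<open>{1..d} \<rightarrow>\<^sub>E UNIV\<close>; indices
  start at 1.
\<close>

definition elem_sym :: "nat \<Rightarrow> nat \<Rightarrow> (nat \<Rightarrow> complex) \<Rightarrow> complex" where
  "elem_sym d i z = (\<Sum>S | S \<subseteq> {1..d} \<and> card S = i. \<Prod>j\<in>S. z j)"

definition closed_polydisc :: "nat \<Rightarrow> (nat \<Rightarrow> complex) set" where
  "closed_polydisc d = {1..d} \<rightarrow>\<^sub>E cball 0 1"

definition sym_polydisc :: "nat \<Rightarrow> (nat \<Rightarrow> complex) set" where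
  "sym_polydisc d = (\<lambda>z. \<lambda>i\<in>{1..d}. elem_sym d i z) ` closed_polydisc d"

text \<open>
  The exponent \<open>m div p\<close> is the quotient of \<open>m\<close> by \<open>p\<close> only when \<open>p dvd m\<close>.
\<close>

definition closed_Theta :: "nat \<Rightarrow> nat \<Rightarrow> nat \<Rightarrow> (nat \<Rightarrow> complex) set" where
  "closed_Theta m p n =
     (\<lambda>z. \<lambda>i\<in>{1..n}. if i = n then (\<Prod>j\<in>{1..n}. z j) ^ (m div p)
                              else elem_sym n i (\<lambda>j. z j ^ m)) ` closed_polydisc n"

text \<open>
  A rational function is an element of the fraction field of the polynomial ring.
  Its modulus at a point is read off from the representation in lowest terms
  (\<^const>\<open>quot_of_fract\<close>), and is infinite at a pole.
\<close>

definition rat_fun_norm :: "complex poly fract \<Rightarrow> complex \<Rightarrow> ennreal" where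
  "rat_fun_norm f z =
     (let (a, b) = quot_of_fract f
      in if poly b z = 0 then \<infinity> else ennreal (cmod (poly a z / poly b z)))"

definition numer_poly :: "nat \<Rightarrow> nat \<Rightarrow> (nat \<Rightarrow> complex) \<Rightarrow> complex poly" where
  "numer_poly p n \<theta> =
     (\<Sum>i=1..n-1. monom ((-1) ^ i * of_nat i * \<theta> i) (i - 1))
     + monom ((-1) ^ n * of_nat n * \<theta> n ^ p) (n - 1)"

text \<open>
  The \<open>i = 0\<close> term of the denominator is split off: its coefficient \<open>\<theta>\<^sub>0\<close> is 1 by convention,
  whereas the function \<open>\<theta>\<close> only represents \<open>\<theta>\<^sub>1, \<dots>, \<theta>\<^sub>n\<close>.
\<close>

definition denom_poly :: "nat \<Rightarrow> (nat \<Rightarrow> complex) \<Rightarrow> complex poly" where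
  "denom_poly n \<theta> =
     [:of_nat n:] + (\<Sum>i=1..n-1. monom ((-1) ^ i * of_nat (n - i) * \<theta> i) i)"

definition f_rat :: "nat \<Rightarrow> nat \<Rightarrow> (nat \<Rightarrow> complex) \<Rightarrow> complex poly fract" where
  "f_rat p n \<theta> = Fract (numer_poly p n \<theta>) (denom_poly n \<theta>)"

end

theory Submission
  imports Defs
begin

text \<open>
  With a tuple \<open>s = (s\<^sub>1, \<dots>, s\<^sub>n)\<close> and \<open>s\<^sub>0 = 1\<close> goes the polynomial
  \<open>P(x) = \<Sum>\<^sub>i (-1)\<^sup>i s\<^sub>i x\<^sup>i\<close>. If \<open>s\<close> consists of the elementary symmetric functions of
  \<open>z\<^sub>1, \<dots>, z\<^sub>n\<close>, then \<open>P(x) = \<Prod>\<^sub>j (1 - z\<^sub>j x)\<close>, whose zeros are the reciprocals of the nonzero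
  \<open>z\<^sub>j\<close>. Hence \<open>s\<close> lies in \<open>\<Gamma>\<^sub>n\<close> exactly when \<open>P\<close> has no zero in the open unit disc
  (lemma \<open>sym_polydisc_iff_zero_free\<close>), and all conditions of the theorem, for
  \<open>s = (\<theta>\<^sub>1, \<dots>, \<theta>\<^sub>n\<^sub>-\<^sub>1, \<theta>\<^sub>n\<^sup>p)\<close>, become statements about \<open>P\<close>.

  The numerator of \<open>f\<close> is \<open>P'\<close> and its denominator is \<open>n P - x P'\<close>, the polar derivative of \<open>P\<close>
  at the origin. If \<open>P\<close> is zero free in the disc, then \<open>\<bar>P'\<bar> \<le> \<bar>n P - x P'\<bar>\<close> there: this is
  Laguerre's theorem, proved here by the Cauchy--Schwarz inequality (\<open>pderiv_le_polar\<close>), and it bounds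
  the reduced fraction \<open>a/b\<close> by 1. Conversely, let \<open>\<bar>a\<bar> \<le> \<bar>b\<bar>\<close> and \<open>b \<noteq> 0\<close> on the closed disc
  and let \<open>d\<close> be the cancelled factor. Then \<open>n P = d (b + x a)\<close>, and \<open>b + x a\<close> has no zero in the
  open disc. A zero of \<open>P\<close> there would have the same multiplicity in \<open>P\<close> as in \<open>d\<close>, while \<open>d\<close>
  divides \<open>P'\<close>, where the multiplicity is smaller by one: a contradiction
  (\<open>zero_free_iff_quotient_bounded\<close>).

  For the last condition, let \<open>A\<close> be the polynomial of \<open>\<alpha>\<close>, and let \<open>B(x) = x\<^sup>n\<^sup>-\<^sup>1 cnj (A (1 / cnj x))\<close>
  be its conjugate reversal. The relation between \<open>s\<close> and \<open>\<alpha>\<close> says that \<open>P = A + c x B\<close> with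
  \<open>c = (-1)\<^sup>n s\<^sub>n\<close>. If \<open>A\<close> is zero free, then \<open>\<bar>B\<bar> \<le> \<bar>A\<bar>\<close> in the disc (\<open>conj_rev_le\<close>), so \<open>P\<close> is
  zero free. In the other direction, if \<open>\<bar>c\<bar> < 1\<close> the relation is solved by
  \<open>(1 - \<bar>c\<bar>\<^sup>2) A = P - c Q\<close> with \<open>Q\<close> the conjugate reversal of \<open>P\<close>, and the same domination
  shows that \<open>A\<close> is zero free (\<open>decomp_strict\<close>). If \<open>\<bar>c\<bar> = 1\<close>, then all \<open>z\<^sub>j\<close> are unimodular, so
  \<open>P = c Q\<close>, and \<open>A = (n P - x P') / n\<close> does it, which is zero free by Laguerre's theorem
  (\<open>decomp_unimodular\<close>).

  The equivalence of the first two conditions is extraction of \<open>m\<close>-th roots, with one root adjusted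
  by a root of unity (\<open>closed_Theta_iff_sym_polydisc\<close>).
\<close>

section \<open>The generating polynomial of the elementary symmetric functions\<close>

definition signed_gen :: "nat \<Rightarrow> (nat \<Rightarrow> complex) \<Rightarrow> complex poly" where
  "signed_gen n s = (\<Sum>i\<le>n. monom (if i = 0 then 1 else (-1) ^ i * s i) i)"

lemma coeff_signed_gen:
  "coeff (signed_gen n s) k = (if k = 0 then 1 else if k \<le> n then (-1) ^ k * s k else 0)"
  by (simp add: signed_gen_def coeff_sum)

lemma degree_signed_gen: "degree (signed_gen n s) \<le> n"
  by (rule degree_le) (simp add: coeff_signed_gen)

lemma poly_signed_gen_0: "poly (signed_gen n s) 0 = 1"
  by (simp add: poly_0_coeff_0 coeff_signed_gen)

text \<open>
  Vieta's formula: expanding the product over the subsets of \<open>{1..d}\<close> that select the linear terms.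
\<close>
lemma coeff_prod_linear:
  "coeff (\<Prod>j\<in>{1..d}. [:1, - z j:]) i = (-1) ^ i * elem_sym d i z"
proof -
  have lin: "[:1, - z j:] = monom (- z j) 1 + 1" for j
    by (simp add: monom_altdef one_pCons)
  have mon: "(\<Prod>j\<in>S. monom (- z j) 1) = monom (\<Prod>j\<in>S. - z j) (card S)" if "finite S" for S
    using that by (induction rule: finite_induct) (simp_all add: mult_monom)
  have "(\<Prod>j\<in>{1..d}. [:1, - z j:]) = (\<Sum>S\<in>Pow {1..d}. \<Prod>j\<in>S. monom (- z j) 1)"
    unfolding lin by (subst prod_add) simp_all
  also have "\<dots> = (\<Sum>S\<in>Pow {1..d}. monom (\<Prod>j\<in>S. - z j) (card S))"
    by (intro sum.cong refl mon) (auto intro: finite_subset)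
  finally have "coeff (\<Prod>j\<in>{1..d}. [:1, - z j:]) i =
      (\<Sum>S\<in>Pow {1..d}. if card S = i then \<Prod>j\<in>S. - z j else 0)"
    by (simp add: coeff_sum)
  also have "\<dots> = (\<Sum>S | S \<subseteq> {1..d} \<and> card S = i. \<Prod>j\<in>S. - z j)"
    by (subst sum.inter_filter [symmetric]) (auto intro!: sum.cong)
  also have "\<dots> = (\<Sum>S | S \<subseteq> {1..d} \<and> card S = i. (-1) ^ i * (\<Prod>j\<in>S. z j))"
    by (intro sum.cong refl) (auto simp: prod_uminus)
  finally show ?thesis
    by (simp add: elem_sym_def sum_distrib_left)
qed

lemma elem_sym_top: "elem_sym d d z = (\<Prod>j\<in>{1..d}. z j)"
proof -
  have "{S. S \<subseteq> {1..d} \<and> card S = d} = {{1..d}}"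
    using card_subset_eq[of "{1..d}"] by auto
  then show ?thesis by (simp add: elem_sym_def)
qed

lemma degree_prod_linear: "degree (\<Prod>j\<in>{1..d::nat}. [:1, - z j:] :: complex poly) \<le> d"
proof -
  have "degree (\<Prod>j\<in>{1..d}. [:1, - z j:]) \<le> (\<Sum>j\<in>{1..d}. degree [:1, - z j:])"
    by (rule degree_prod_sum_le [unfolded o_def]) simp
  also have "\<dots> \<le> (\<Sum>j\<in>{1..d}. 1)" by (intro sum_mono) simp
  finally show ?thesis by simp
qed

lemma signed_gen_elem_sym:
  "signed_gen d (\<lambda>i\<in>{1..d}. elem_sym d i z) = (\<Prod>j\<in>{1..d}. [:1, - z j:])"
proof (rule poly_eqI)
  fix k
  show "coeff (signed_gen d (\<lambda>i\<in>{1..d}. elem_sym d i z)) k = coeff (\<Prod>j\<in>{1..d}. [:1, - z j:]) k"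
  proof (cases "k = 0")
    case True
    then show ?thesis
      by (simp only: poly_0_coeff_0 [symmetric] poly_signed_gen_0) (simp add: poly_prod)
  next
    case False
    show ?thesis
    proof (cases "k \<le> d")
      case True
      with False show ?thesis by (simp add: coeff_signed_gen coeff_prod_linear del: One_nat_def)
    next
      case False
      then have "coeff (\<Prod>j\<in>{1..d}. [:1, - z j:]) k = 0"
        using degree_prod_linear[of z d] by (intro coeff_eq_0) simp
      with False show ?thesis by (simp add: coeff_signed_gen)
    qed
  qed
qed

lemma signed_gen_inject:
  assumes "s \<in> {1..n} \<rightarrow>\<^sub>E UNIV" "t \<in> {1..n} \<rightarrow>\<^sub>E UNIV" "signed_gen n s = signed_gen n t"
  shows "s = t"
proof (rule PiE_ext[OF assms(1,2)])
  fix i assume "i \<in> {1..n}"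
  then show "s i = t i"
    using arg_cong[OF assms(3), of "\<lambda>P. coeff P i"] by (simp add: coeff_signed_gen)
qed

text \<open>
  The linear factor of a zero \<open>a\<close> is rescaled to \<open>1 - x / a\<close>, with \<open>\<bar>1 / a\<bar> \<le> 1\<close>. Missing degree is
  made up by the parameter 0, whose factor is 1.
\<close>
lemma zero_free_imp_factors:
  fixes P :: "complex poly"
  assumes "degree P \<le> n" "poly P 0 = 1" "\<And>x. cmod x < 1 \<Longrightarrow> poly P x \<noteq> 0"
  shows "\<exists>z\<in>closed_polydisc n. P = (\<Prod>j\<in>{1..n}. [:1, - z j:])"
  using assms
proof (induction n arbitrary: P)
  case 0
  then obtain c where "P = [:c:]" by (auto elim: degree_eq_zeroE)
  with 0 show ?case by (simp add: closed_polydisc_def one_pCons)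
next
  case (Suc n)
  have "\<exists>Q w. degree Q \<le> n \<and> cmod w \<le> 1 \<and> P = [:1, - w:] * Q"
  proof (cases "degree P = 0")
    case True
    then show ?thesis by (intro exI[of _ P] exI[of _ 0]) (simp add: one_pCons[symmetric])
  next
    case False
    then obtain a where a: "poly P a = 0"
      using fundamental_theorem_of_algebra constant_degree by metis
    have a1: "cmod a \<ge> 1" using Suc.prems(3) a by force
    then have a0: "a \<noteq> 0" by auto
    obtain R where R: "P = [:- a, 1:] * R" using a by (auto simp: poly_eq_0_iff_dvd)
    have "R \<noteq> 0" using Suc.prems(2) R by auto
    then have "degree P = Suc (degree R)" by (simp add: R degree_mult_eq del: mult_pCons_left)
    moreover have "P = [:1, - (1 / a):] * smult (- a) R"
      using a0 unfolding R by (intro poly_eqI) (simp add: coeff_pCons algebra_simps split: nat.split)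
    moreover have "cmod (1 / a) \<le> 1" using a1 by (simp add: norm_divide divide_simps)
    ultimately show ?thesis using Suc.prems(1)
      by (intro exI[of _ "smult (- a) R"] exI[of _ "1 / a"]) auto
  qed
  then obtain Q w where Q: "degree Q \<le> n" "cmod w \<le> 1" "P = [:1, - w:] * Q" by blast
  have "poly Q 0 = 1" using Suc.prems(2) Q(3) by simp
  moreover have "poly Q x \<noteq> 0" if "cmod x < 1" for x
    using Suc.prems(3)[OF that] Q(3) by auto
  ultimately obtain z where z: "z \<in> closed_polydisc n" "Q = (\<Prod>j\<in>{1..n}. [:1, - z j:])"
    using Suc.IH[of Q] Q(1) by blast
  have "(\<Prod>j\<in>{1..Suc n}. [:1, - (z(Suc n := w)) j:]) = [:1, - w:] * (\<Prod>j\<in>{1..n}. [:1, - z j:])"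
    by (subst atLeastAtMostSuc_conv) (auto simp: prod.insert simp del: mult_pCons_left intro!: prod.cong arg_cong2[of _ _ _ _ "(*)"])
  moreover have "z(Suc n := w) \<in> closed_polydisc (Suc n)"
    using z(1) Q(2) by (auto simp: closed_polydisc_def PiE_iff extensional_def)
  ultimately show ?case using z(2) Q(3) by metis
qed

lemma poly_prod_linear_nonzero:
  assumes "z \<in> closed_polydisc n" "cmod x < 1"
  shows "poly (\<Prod>j\<in>{1..n}. [:1, - z j:]) x \<noteq> 0"
proof -
  have "1 - x * z j \<noteq> 0" if "j \<in> {1..n}" for j
  proof
    assume "1 - x * z j = 0"
    then have "cmod x * cmod (z j) = 1" by (simp flip: norm_mult)
    moreover have "cmod (z j) \<le> 1" using assms(1) that by (auto simp: closed_polydisc_def PiE_iff)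
    ultimately show False using assms(2)
      by (metis mult.right_neutral mult_left_mono norm_ge_zero not_less)
  qed
  then show ?thesis by (auto simp: poly_prod)
qed

section \<open>The symmetrized polydisc through zero-free polynomials\<close>

lemma sym_polydisc_iff_factors:
  assumes "s \<in> {1..n} \<rightarrow>\<^sub>E UNIV"
  shows "s \<in> sym_polydisc n \<longleftrightarrow>
    (\<exists>z\<in>closed_polydisc n. signed_gen n s = (\<Prod>j\<in>{1..n}. [:1, - z j:]))"
proof
  assume "s \<in> sym_polydisc n"
  then show "\<exists>z\<in>closed_polydisc n. signed_gen n s = (\<Prod>j\<in>{1..n}. [:1, - z j:])"
    unfolding sym_polydisc_def using signed_gen_elem_sym by blast
next
  assume "\<exists>z\<in>closed_polydisc n. signed_gen n s = (\<Prod>j\<in>{1..n}. [:1, - z j:])"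
  then obtain z where z: "z \<in> closed_polydisc n" "signed_gen n s = (\<Prod>j\<in>{1..n}. [:1, - z j:])"
    by blast
  have "s = (\<lambda>i\<in>{1..n}. elem_sym n i z)"
    using assms
  proof (rule signed_gen_inject)
    show "(\<lambda>i\<in>{1..n}. elem_sym n i z) \<in> {1..n} \<rightarrow>\<^sub>E UNIV" by simp
    show "signed_gen n s = signed_gen n (\<lambda>i\<in>{1..n}. elem_sym n i z)"
      using z(2) by (simp only: signed_gen_elem_sym)
  qed
  with z(1) show "s \<in> sym_polydisc n" by (auto simp: sym_polydisc_def)
qed

lemma sym_polydisc_iff_zero_free:
  assumes "s \<in> {1..n} \<rightarrow>\<^sub>E UNIV"
  shows "s \<in> sym_polydisc n \<longleftrightarrow> (\<forall>x. cmod x < 1 \<longrightarrow> poly (signed_gen n s) x \<noteq> 0)"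
  using sym_polydisc_iff_factors[OF assms] poly_prod_linear_nonzero
    zero_free_imp_factors[OF degree_signed_gen poly_signed_gen_0, of n s] by metis

lemma sym_polydisc_extensional: "s \<in> sym_polydisc n \<Longrightarrow> s \<in> {1..n} \<rightarrow>\<^sub>E UNIV"
  by (auto simp: sym_polydisc_def)

lemma sym_polydisc_last_le:
  assumes "n > 0" "s \<in> sym_polydisc n"
  shows "cmod (s n) \<le> 1"
proof -
  obtain z where "z \<in> closed_polydisc n" "s = (\<lambda>i\<in>{1..n}. elem_sym n i z)"
    using assms(2) by (auto simp: sym_polydisc_def)
  then show ?thesis using assms(1)
    by (auto simp: elem_sym_top prod_norm [symmetric] closed_polydisc_def PiE_iff intro!: prod_le_1)
qed

section \<open>Conjugate reversal\<close>

text \<open>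
  For \<open>P\<close> of degree at most \<open>n\<close> this is \<open>x\<^sup>n cnj (P (1 / cnj x))\<close>, written through coefficients so
  that it is a polynomial also at 0.
\<close>
definition conj_rev :: "nat \<Rightarrow> complex poly \<Rightarrow> complex poly" where
  "conj_rev n P = (\<Sum>i\<le>n. monom (cnj (coeff P (n - i))) i)"

lemma coeff_conj_rev:
  "coeff (conj_rev n P) k = (if k \<le> n then cnj (coeff P (n - k)) else 0)"
  by (simp add: conj_rev_def coeff_sum)

text \<open>
  Conjugate reversal is multiplicative when the formal degree \<open>n\<close> is counted along, so it acts on the
  linear factors one by one.
\<close>
lemma conj_rev_prod_linear:
  fixes z :: "nat \<Rightarrow> complex"
  shows "conj_rev n (\<Prod>j\<in>{1..n}. [:1, - z j:]) = (\<Prod>j\<in>{1..n}. [:- cnj (z j), 1:])"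
proof (induction n)
  case 0
  show ?case by (rule poly_eqI) (simp add: coeff_conj_rev)
next
  case (Suc n)
  let ?P = "\<Prod>j\<in>{1..n}. [:1, - z j:]"
  have z: "coeff ?P (Suc n) = 0"
    using degree_prod_linear[of z n] by (intro coeff_eq_0) simp
  have "conj_rev (Suc n) ([:1, - z (Suc n):] * ?P) = [:- cnj (z (Suc n)), 1:] * conj_rev n ?P"
    (is "?L = ?R")
  proof (rule poly_eqI)
    fix k
    consider "k = 0" | j where "k = Suc j" "j < n" | "k = Suc n" | "k > Suc n"
      by (metis less_antisym linorder_neqE_nat not_less_eq old.nat.exhaust)
    then show "coeff ?L k = coeff ?R k"
    proof cases
      case 2
      then have "Suc n - k = Suc (n - k)" "n - j = Suc (n - k)" by auto
      with 2 show ?thesis by (simp add: coeff_conj_rev coeff_pCons)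
    qed (use z in \<open>auto simp: coeff_conj_rev coeff_pCons split: nat.split\<close>)
  qed
  then show ?case using Suc.IH
    by (simp add: atLeastAtMostSuc_conv del: mult_pCons_left)
qed

text \<open>
  Factorwise this is the fact that \<open>(x - cnj w) / (1 - x w)\<close> maps the disc into itself: the difference
  of the squared moduli is \<open>(1 - \<bar>x\<bar>\<^sup>2) (1 - \<bar>w\<bar>\<^sup>2)\<close>.
\<close>
lemma conj_rev_le:
  assumes "z \<in> closed_polydisc n" "cmod x \<le> 1"
  shows "cmod (poly (conj_rev n (\<Prod>j\<in>{1..n}. [:1, - z j:])) x)
       \<le> cmod (poly (\<Prod>j\<in>{1..n}. [:1, - z j:]) x)"
proof -
  have "cmod (x - cnj w) \<le> cmod (1 - x * w)" if "cmod w \<le> 1" for w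
  proof -
    have "(cmod (1 - x * w))\<^sup>2 - (cmod (x - cnj w))\<^sup>2 = (1 - (cmod x)\<^sup>2) * (1 - (cmod w)\<^sup>2)"
      unfolding cmod_power2 by (simp add: power2_eq_square algebra_simps)
    also have "\<dots> \<ge> 0" using that assms(2) by (simp add: power_le_one)
    finally show ?thesis by (intro power2_le_imp_le[of "cmod (x - cnj w)"]) simp_all
  qed
  moreover have "\<forall>j\<in>{1..n}. cmod (z j) \<le> 1"
    using assms(1) by (auto simp: closed_polydisc_def PiE_iff)
  ultimately have "(\<Prod>j\<in>{1..n}. cmod (x - cnj (z j))) \<le> (\<Prod>j\<in>{1..n}. cmod (1 - x * z j))"
    by (intro prod_mono) simp
  then show ?thesis
    unfolding conj_rev_prod_linear by (simp add: poly_prod prod_norm)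
qed


section \<open>The polar derivative and Laguerre's inequality\<close>

text \<open>
  The polar derivative at the origin of \<open>P\<close>, regarded as a polynomial of formal degree \<open>n\<close>.
\<close>
definition polar :: "nat \<Rightarrow> complex poly \<Rightarrow> complex poly" where
  "polar n P = smult (of_nat n) P - pCons 0 (pderiv P)"

lemma poly_polar: "poly (polar n P) x = of_nat n * poly P x - x * poly (pderiv P) x"
  by (simp add: polar_def)

lemma coeff_polar: "coeff (polar n P) k = (of_nat n - of_nat k) * coeff P k"
  by (cases k) (simp_all add: polar_def coeff_pderiv algebra_simps)

lemma numer_poly_eq_pderiv:
  assumes "n \<ge> 1"
  shows "numer_poly p n \<theta> = pderiv (signed_gen n (\<theta>(n := \<theta> n ^ p)))"
proof (rule poly_eqI)
  fix k
  have "coeff (numer_poly p n \<theta>) k =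
      (\<Sum>i=1..n-1. if i = Suc k then (-1) ^ i * of_nat i * \<theta> i else 0)
      + (if n = Suc k then (-1) ^ n * of_nat n * \<theta> n ^ p else 0)"
    unfolding numer_poly_def coeff_add coeff_sum using assms
    by (intro arg_cong2[of _ _ _ _ "(+)"] sum.cong) auto
  also have "\<dots> = coeff (pderiv (signed_gen n (\<theta>(n := \<theta> n ^ p)))) k"
    using assms by (auto simp: coeff_pderiv coeff_signed_gen)
  finally show "coeff (numer_poly p n \<theta>) k = coeff (pderiv (signed_gen n (\<theta>(n := \<theta> n ^ p)))) k" .
qed

lemma denom_poly_eq_polar:
  assumes "n \<ge> 1"
  shows "denom_poly n \<theta> = polar n (signed_gen n (\<theta>(n := \<theta> n ^ p)))"
proof (rule poly_eqI)
  fix k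
  have "coeff (denom_poly n \<theta>) k = (if k = 0 then of_nat n else 0)
      + (\<Sum>i=1..n-1. if i = k then (-1) ^ i * of_nat (n - i) * \<theta> i else 0)"
    unfolding denom_poly_def coeff_add coeff_sum
    by (intro arg_cong2[of _ _ _ _ "(+)"] sum.cong) (auto simp: coeff_pCons split: nat.split)
  also have "\<dots> = coeff (polar n (signed_gen n (\<theta>(n := \<theta> n ^ p)))) k"
    using assms by (auto simp: coeff_polar coeff_signed_gen of_nat_diff)
  finally show "coeff (denom_poly n \<theta>) k = coeff (polar n (signed_gen n (\<theta>(n := \<theta> n ^ p)))) k" .
qed

text \<open>The logarithmic derivative of the product.\<close>
lemma poly_pderiv_prod_linear:
  fixes x :: complex
  assumes "finite A" "\<And>j. j \<in> A \<Longrightarrow> 1 - x * z j \<noteq> 0"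
  shows "poly (pderiv (\<Prod>j\<in>A. [:1, - z j:])) x =
    - poly (\<Prod>j\<in>A. [:1, - z j:]) x * (\<Sum>j\<in>A. z j / (1 - x * z j))"
  using assms
proof (induction rule: finite_induct)
  case (insert a A)
  have "1 - x * z a \<noteq> 0" using insert by simp
  moreover have "poly (pderiv (\<Prod>j\<in>A. [:1, - z j:])) x =
      - poly (\<Prod>j\<in>A. [:1, - z j:]) x * (\<Sum>j\<in>A. z j / (1 - x * z j))"
    using insert by simp
  ultimately show ?case using insert.hyps
    by (simp add: pderiv_mult pderiv_pCons field_simps del: mult_pCons_left)
qed simp

text \<open>
  With \<open>v\<^sub>j = z\<^sub>j / (1 - x z\<^sub>j)\<close> and \<open>V = \<Sum>\<^sub>j v\<^sub>j\<close>, the derivative is \<open>- P V\<close> and the polar derivative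
  is \<open>P (n + x V)\<close>, so the claim is \<open>\<bar>V\<bar> \<le> \<bar>n + x V\<bar>\<close>. For a single \<open>j\<close> the inequality
  \<open>\<bar>v\<^sub>j\<bar> \<le> \<bar>1 + x v\<^sub>j\<bar>\<close> is just \<open>\<bar>z\<^sub>j\<bar> \<le> 1\<close>. Expanded, it says that a quadratic form in \<open>v\<^sub>j\<close> is
  bounded by an affine function of \<open>v\<^sub>j\<close>. Such inequalities can be averaged over \<open>j\<close>, the
  Cauchy--Schwarz inequality taking care of the quadratic term.
\<close>
lemma pderiv_le_polar:
  assumes z: "z \<in> closed_polydisc n" and x: "cmod x < 1"
  defines "P \<equiv> \<Prod>j\<in>{1..n}. [:1, - z j:]"
  shows "cmod (poly (pderiv P) x) \<le> cmod (poly (polar n P) x)"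
proof -
  have ne: "1 - x * z j \<noteq> 0" if "j \<in> {1..n}" for j
    using poly_prod_linear_nonzero[OF z x] that by (auto simp: poly_prod)
  define v where "v j = z j / (1 - x * z j)" for j
  define V where "V = (\<Sum>j\<in>{1..n}. v j)"
  define r where "r = 1 - (cmod x)\<^sup>2"
  have r: "r \<ge> 0" using x by (simp add: r_def power_le_one)
  have pd: "poly (pderiv P) x = - poly P x * V"
    unfolding P_def V_def v_def by (rule poly_pderiv_prod_linear) (use ne in auto)
  have polar: "poly (polar n P) x = poly P x * (of_nat n + x * V)"
    by (simp add: poly_polar pd algebra_simps)
  \<comment> \<open>used with \<open>c = 1\<close> for the single terms and with \<open>c = n\<close> for their sum\<close>
  have expand: "(cmod (c + x * w))\<^sup>2 - (cmod w)\<^sup>2 = (Re c)\<^sup>2 + 2 * Re c * Re (x * w) - r * (cmod w)\<^sup>2"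
    if "Im c = 0" for c w
    unfolding r_def cmod_power2 using that by (simp add: power2_eq_square algebra_simps)
  have v: "r * (cmod (v j))\<^sup>2 \<le> 1 + 2 * Re (x * v j)" if j: "j \<in> {1..n}" for j
  proof -
    have "1 + x * v j = 1 / (1 - x * z j)" using ne[OF j] by (simp add: v_def field_simps)
    moreover have "cmod (z j) \<le> 1" using z j by (auto simp: closed_polydisc_def PiE_iff)
    ultimately have "cmod (v j) \<le> cmod (1 + x * v j)"
      by (simp add: v_def norm_divide divide_right_mono)
    then have "(cmod (v j))\<^sup>2 \<le> (cmod (1 + x * v j))\<^sup>2" by simp
    moreover have "(cmod (1 + x * v j))\<^sup>2 - (cmod (v j))\<^sup>2 =
        1 + 2 * Re (x * v j) - r * (cmod (v j))\<^sup>2"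
      using expand[of 1 "v j"] by (simp del: times_complex.sel)
    ultimately show ?thesis by linarith
  qed
  have "(cmod V)\<^sup>2 \<le> (\<Sum>j\<in>{1..n}. cmod (v j))\<^sup>2"
    unfolding V_def by (intro power_mono norm_sum) simp
  also have "\<dots> \<le> (\<Sum>j\<in>{1..n}. (cmod (v j))\<^sup>2) * real n"
    using sum_squared_le_sum_of_squares[of "\<lambda>j. cmod (v j)" "{1..n}"] by simp
  finally have "r * (cmod V)\<^sup>2 \<le> (\<Sum>j\<in>{1..n}. r * (cmod (v j))\<^sup>2) * real n"
    using r by (simp add: mult_left_mono sum_distrib_left [symmetric] mult.assoc)
  also have "\<dots> \<le> (\<Sum>j\<in>{1..n}. 1 + 2 * Re (x * v j)) * real n"
    by (intro mult_right_mono sum_mono v) auto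
  also have "\<dots> = (real n)\<^sup>2 + 2 * real n * Re (x * V)"
    unfolding sum.distrib sum_distrib_left [symmetric] V_def Re_sum [symmetric]
    by (simp add: power2_eq_square algebra_simps)
  finally have "r * (cmod V)\<^sup>2 \<le> (real n)\<^sup>2 + 2 * real n * Re (x * V)" .
  moreover have "(cmod (of_nat n + x * V))\<^sup>2 - (cmod V)\<^sup>2 =
      (real n)\<^sup>2 + 2 * real n * Re (x * V) - r * (cmod V)\<^sup>2"
    using expand[of "of_nat n" V] by (simp del: times_complex.sel)
  ultimately have "(cmod V)\<^sup>2 \<le> (cmod (of_nat n + x * V))\<^sup>2" by linarith
  then have "cmod V \<le> cmod (of_nat n + x * V)" by (rule power2_le_imp_le) simp
  then show ?thesis by (simp add: pd polar norm_mult mult_left_mono)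
qed

section \<open>Bounded quotients\<close>

text \<open>
  Deleting finitely many points leaves every point of the closed disc a limit point of the rest of the
  open disc, and the inequality passes to limits.
\<close>
lemma poly_le_closed_disc:
  fixes a b :: "complex poly"
  assumes F: "finite F" and le: "\<And>x. cmod x < 1 \<Longrightarrow> x \<notin> F \<Longrightarrow> cmod (poly a x) \<le> cmod (poly b x)"
    and x: "cmod x \<le> 1"
  shows "cmod (poly a x) \<le> cmod (poly b x)"
proof -
  let ?C = "{x. cmod (poly a x) \<le> cmod (poly b x)}"
  have "closed ?C" by (intro closed_Collect_le continuous_intros)
  have "x islimpt ball 0 1" using x by (simp add: islimpt_ball)
  then have "x islimpt F \<union> (ball 0 1 - F)" by (rule islimpt_subset) auto
  then have "x islimpt ball 0 1 - F" using F by (simp only: islimpt_Un_finite)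
  then have "x islimpt ?C" by (rule islimpt_subset) (use le in auto)
  with \<open>closed ?C\<close> show ?thesis by (auto simp: closed_limpt)
qed

lemma sup_rat_fun_norm_le_1_iff:
  "(SUP z\<in>cball 0 1. rat_fun_norm f z) \<le> 1 \<longleftrightarrow>
    (\<forall>x. cmod x \<le> 1 \<longrightarrow> poly (snd (quot_of_fract f)) x \<noteq> 0 \<and>
      cmod (poly (fst (quot_of_fract f)) x) \<le> cmod (poly (snd (quot_of_fract f)) x))"
proof -
  have "rat_fun_norm f x \<le> 1 \<longleftrightarrow> poly (snd (quot_of_fract f)) x \<noteq> 0 \<and>
      cmod (poly (fst (quot_of_fract f)) x) \<le> cmod (poly (snd (quot_of_fract f)) x)" for x
    by (auto simp: rat_fun_norm_def case_prod_unfold Let_def norm_divide ennreal_le_1 top_unique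
      divide_le_eq_1 split: if_splits)
  then show ?thesis by (auto simp: SUP_le_iff)
qed

text \<open>The witness \<open>d\<close> is the factor cancelled when the fraction is put in lowest terms.\<close>
lemma quot_of_fract_Fract_E:
  fixes A B :: "complex poly"
  assumes "B \<noteq> 0"
  obtains d where "A = fst (quot_of_fract (Fract A B)) * d" "B = snd (quot_of_fract (Fract A B)) * d"
proof -
  have "quot_of_fract (Fract A B) = normalize_quot (A, B)"
    using assms quot_of_fract_quot_to_fract[of "(A, B)"] by (simp add: quot_to_fract_def Fract.abs_eq)
  then show ?thesis using normalize_quotE[OF assms] that by metis
qed

text \<open>
  From left to right, Laguerre's inequality survives division by the cancelled factor \<open>d\<close> and passage
  to the boundary; a pole \<open>x\<close> in the closed disc would then be a common zero of numerator and
  denominator in lowest terms. From right to left, a zero of \<open>P\<close> in the open disc has the same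
  multiplicity in \<open>d\<close> as in \<open>P\<close>, too much for the divisor \<open>d\<close> of \<open>P'\<close>.
\<close>
lemma zero_free_iff_quotient_bounded:
  fixes P :: "complex poly"
  assumes n: "n \<ge> 1" and deg: "degree P \<le> n" and P0: "poly P 0 = 1"
  shows "(\<forall>x. cmod x < 1 \<longrightarrow> poly P x \<noteq> 0) \<longleftrightarrow>
    (SUP z\<in>cball 0 1. rat_fun_norm (Fract (pderiv P) (polar n P)) z) \<le> 1"
proof -
  have "poly (polar n P) 0 \<noteq> 0" using n P0 by (simp add: poly_polar)
  then have Q0: "polar n P \<noteq> 0" by auto
  define a where "a = fst (quot_of_fract (Fract (pderiv P) (polar n P)))"
  define b where "b = snd (quot_of_fract (Fract (pderiv P) (polar n P)))"
  obtain d where d: "pderiv P = a * d" "polar n P = b * d"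
    using quot_of_fract_Fract_E[OF Q0, of "pderiv P"] unfolding a_def b_def by blast
  have cop: "coprime a b" unfolding a_def b_def by (rule coprime_quot_of_fract)
  have d0: "d \<noteq> 0" using Q0 d(2) by auto
  have iff: "(SUP z\<in>cball 0 1. rat_fun_norm (Fract (pderiv P) (polar n P)) z) \<le> 1 \<longleftrightarrow>
      (\<forall>x. cmod x \<le> 1 \<longrightarrow> poly b x \<noteq> 0 \<and> cmod (poly a x) \<le> cmod (poly b x))"
    by (simp add: sup_rat_fun_norm_le_1_iff a_def b_def)
  show ?thesis unfolding iff
  proof (intro iffI allI impI)
    fix x assume zf: "\<forall>x. cmod x < 1 \<longrightarrow> poly P x \<noteq> 0" and x: "cmod x \<le> 1"
    obtain z where z: "z \<in> closed_polydisc n" "P = (\<Prod>j\<in>{1..n}. [:1, - z j:])"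
      using zero_free_imp_factors[OF deg P0] zf by blast
    have le: "cmod (poly a x) \<le> cmod (poly b x)"
    proof (rule poly_le_closed_disc[OF poly_roots_finite[OF d0] _ x])
      fix y assume y: "cmod y < 1" "y \<notin> {y. poly d y = 0}"
      have "cmod (poly (a * d) y) \<le> cmod (poly (b * d) y)"
        using pderiv_le_polar[OF z(1) y(1)] unfolding z(2)[symmetric] d .
      with y(2) show "cmod (poly a y) \<le> cmod (poly b y)"
        by (simp add: norm_mult)
    qed
    moreover have "poly b x \<noteq> 0"
    proof
      assume "poly b x = 0"
      with le have "[:- x, 1:] dvd a" "[:- x, 1:] dvd b" by (auto simp: poly_eq_0_iff_dvd)
      with cop have "is_unit [:- x, 1:]" by (rule coprime_common_divisor)
      then show False by (simp add: is_unit_pCons_iff)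
    qed
    ultimately show "poly b x \<noteq> 0 \<and> cmod (poly a x) \<le> cmod (poly b x)" by blast
  next
    fix x assume ab: "\<forall>x. cmod x \<le> 1 \<longrightarrow> poly b x \<noteq> 0 \<and> cmod (poly a x) \<le> cmod (poly b x)"
      and x: "cmod x < 1"
    have b: "poly b x \<noteq> 0" "cmod (poly a x) \<le> cmod (poly b x)" using ab x by auto
    \<comment> \<open>the cofactor of \<open>d\<close> in \<open>n P = polar n P + x P'\<close>\<close>
    define h where "h = b + [:0, 1:] * a"
    have nP: "smult (of_nat n) P = d * h"
      using d by (simp add: polar_def h_def algebra_simps)
    have "cmod (x * poly a x) < cmod (poly b x)"
    proof -
      have "cmod (x * poly a x) \<le> cmod x * cmod (poly b x)"
        by (simp add: norm_mult b(2) mult_left_mono)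
      also have "\<dots> < cmod (poly b x)" using b(1) x by simp
      finally show ?thesis .
    qed
    then have "poly h x \<noteq> 0"
      by (auto simp: h_def add_eq_0_iff)
    then have "order x h = 0" by (simp add: order_root)
    moreover have P: "P \<noteq> 0" using P0 by auto
    moreover have "smult (of_nat n) P \<noteq> 0" using P n by simp
    ultimately have "order x (smult (of_nat n) P) = order x d"
      unfolding nP by (simp add: order_mult)
    then have ord: "order x P = order x d" using n by (simp add: order_smult)
    show "poly P x \<noteq> 0"
    proof
      assume root: "poly P x = 0"
      have "pderiv P \<noteq> 0"
      proof
        assume "pderiv P = 0"
        then obtain c where "P = [:c:]" by (auto simp: pderiv_eq_0_iff elim: degree_eq_zeroE)
        with root P0 show False by simp
      qed
      then have "order x d \<le> order x (pderiv P)"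
        unfolding d(1) by (simp add: order_mult)
      moreover have "order x P = Suc (order x (pderiv P))"
        using \<open>pderiv P \<noteq> 0\<close> root P by (intro order_pderiv) (auto simp: order_root)
      ultimately show False using ord by simp
    qed
  qed
qed

section \<open>Splitting off the last coordinate\<close>

lemma add_dominated_nonzero:
  fixes A B :: "complex poly"
  assumes "poly A x \<noteq> 0" "cmod (poly B x) \<le> cmod (poly A x)" "cmod c < 1"
  shows "poly A x + c * poly B x \<noteq> 0"
proof
  assume "poly A x + c * poly B x = 0"
  then have "poly A x = - (c * poly B x)" by (simp add: eq_neg_iff_add_eq_0)
  then have "cmod (poly A x) = cmod c * cmod (poly B x)" by (simp add: norm_mult)
  also have "\<dots> \<le> cmod c * cmod (poly A x)" using assms(2) by (rule mult_left_mono) simp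
  also have "\<dots> < cmod (poly A x)" using assms(1,3) by simp
  finally show False by simp
qed

lemma neg_one_power_cancel:
  assumes "k \<le> n"
  shows "(-1::complex) ^ n * (-1) ^ (n - k) = (-1) ^ k"
proof -
  have "(-1::complex) ^ n = (-1) ^ (k + (n - k))" using assms by simp
  then show ?thesis by (simp add: power_add mult.assoc flip: power_mult_distrib)
qed

text \<open>
  The coordinate relations as one polynomial identity. The polynomial of \<open>\<alpha>\<close> has formal degree
  \<open>n - 1\<close>; its reversal is multiplied by \<open>x\<close> so that its constant term 1 accounts for the top
  coefficient \<open>(-1)\<^sup>n s\<^sub>n\<close>.
\<close>
lemma signed_gen_decomp:
  assumes n: "n \<ge> 1" and rep: "\<And>i. i \<in> {1..n-1} \<Longrightarrow> s i = \<alpha> i + cnj (\<alpha> (n - i)) * s n"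
  defines "A \<equiv> signed_gen (n - 1) \<alpha>"
  shows "signed_gen n s = A + smult ((-1) ^ n * s n) (pCons 0 (conj_rev (n - 1) A))"
proof (rule poly_eqI)
  fix k
  consider "k = 0" | "k = n" "k \<noteq> 0" | "k > n" | "k \<in> {1..n-1}" by force
  then show "coeff (signed_gen n s) k =
      coeff (A + smult ((-1) ^ n * s n) (pCons 0 (conj_rev (n - 1) A))) k"
  proof cases
    case 4
    then obtain j where j: "k = Suc j" "j < n - 1" by (cases k) auto
    have "(-1::complex) ^ n * (-1) ^ (n - k) = (-1) ^ k"
      using 4 by (intro neg_one_power_cancel) auto
    moreover have "n - Suc 0 - j = n - k" "n - k \<noteq> 0" "n - k \<le> n - 1" using 4 j by auto
    ultimately show ?thesis using 4 j rep[OF 4]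
      by (simp add: A_def coeff_signed_gen coeff_conj_rev algebra_simps)
  qed (use n in \<open>auto simp: A_def coeff_signed_gen coeff_conj_rev coeff_pCons split: nat.split\<close>)
qed

lemma sym_polydisc_if_decomp:
  assumes n: "n \<ge> 1" and s: "s \<in> {1..n} \<rightarrow>\<^sub>E UNIV" "cmod (s n) \<le> 1"
    and \<alpha>: "\<alpha> \<in> sym_polydisc (n - 1)"
    and rep: "\<And>i. i \<in> {1..n-1} \<Longrightarrow> s i = \<alpha> i + cnj (\<alpha> (n - i)) * s n"
  shows "s \<in> sym_polydisc n"
  unfolding sym_polydisc_iff_zero_free[OF s(1)]
proof (intro allI impI)
  fix x assume x: "cmod x < 1"
  let ?A = "signed_gen (n - 1) \<alpha>"
  obtain z where z: "z \<in> closed_polydisc (n - 1)" "?A = (\<Prod>j\<in>{1..n-1}. [:1, - z j:])"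
    using \<alpha> sym_polydisc_iff_factors[OF sym_polydisc_extensional[OF \<alpha>]] by blast
  have "poly ?A x + ((-1) ^ n * s n * x) * poly (conj_rev (n - 1) ?A) x \<noteq> 0"
  proof (rule add_dominated_nonzero)
    show "poly ?A x \<noteq> 0" unfolding z(2) using z(1) x by (rule poly_prod_linear_nonzero)
    show "cmod (poly (conj_rev (n - 1) ?A) x) \<le> cmod (poly ?A x)"
      unfolding z(2) using z(1) x by (intro conj_rev_le) auto
    have "cmod ((-1) ^ n * s n * x) \<le> cmod x"
      using s(2) by (simp add: norm_mult norm_power mult_left_le_one_le)
    then show "cmod ((-1) ^ n * s n * x) < 1" using x by simp
  qed
  then show "poly (signed_gen n s) x \<noteq> 0"
    by (subst signed_gen_decomp[OF n rep]) (simp_all add: algebra_simps)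
qed

lemma unimodular_factors:
  assumes z: "z \<in> closed_polydisc n" "cmod (\<Prod>j\<in>{1..n}. z j) = 1" and j: "j \<in> {1..n}"
  shows "cmod (z j) = 1"
proof -
  have le: "cmod (z i) \<le> 1" if "i \<in> {1..n}" for i
    using z(1) that by (auto simp: closed_polydisc_def PiE_iff)
  have "1 = cmod (z j) * (\<Prod>i\<in>{1..n} - {j}. cmod (z i))"
    using z(2) j by (simp add: prod_norm [symmetric] prod.remove)
  also have "\<dots> \<le> cmod (z j)"
    using le by (intro mult_right_le_one_le prod_le_1 prod_nonneg) auto
  finally show ?thesis using le[OF j] by simp
qed

text \<open>Factorwise, \<open>- z (x - cnj z) = 1 - z x\<close> when \<open>\<bar>z\<bar> = 1\<close>.\<close>
lemma self_inversive:
  assumes z: "z \<in> closed_polydisc n" "cmod (\<Prod>j\<in>{1..n}. z j) = 1"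
  defines "P \<equiv> \<Prod>j\<in>{1..n}. [:1, - z j:]"
  shows "smult ((-1) ^ n * (\<Prod>j\<in>{1..n}. z j)) (conj_rev n P) = P"
proof -
  have "(-1) ^ n * (\<Prod>j\<in>{1..n}. z j) = (\<Prod>j\<in>{1..n}. - z j)"
    by (simp add: prod_uminus)
  then have "smult ((-1) ^ n * (\<Prod>j\<in>{1..n}. z j)) (conj_rev n P) =
      (\<Prod>j\<in>{1..n}. smult (- z j) [:- cnj (z j), 1:])"
    unfolding P_def conj_rev_prod_linear by (simp only: prod_smult)
  also have "\<dots> = P"
    unfolding P_def
  proof (rule prod.cong)
    fix j assume "j \<in> {1..n}"
    then have "z j * cnj (z j) = 1" using unimodular_factors[OF z] complex_norm_square[of "z j"] by simp
    then show "smult (- z j) [:- cnj (z j), 1:] = [:1, - z j:]" by simp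
  qed simp
  finally show ?thesis .
qed


lemma reciprocal_coeffs:
  assumes s: "s \<in> sym_polydisc n" "cmod (s n) = 1" and k: "k \<in> {1..n-1}"
  shows "s k = cnj (s (n - k)) * s n"
proof -
  obtain z where z: "z \<in> closed_polydisc n" "s = (\<lambda>i\<in>{1..n}. elem_sym n i z)"
    using s(1) by (auto simp: sym_polydisc_def)
  have P: "signed_gen n s = (\<Prod>j\<in>{1..n}. [:1, - z j:])"
    unfolding z(2) by (rule signed_gen_elem_sym)
  have "n \<in> {1..n}" using k by auto
  then have sn: "s n = (\<Prod>j\<in>{1..n}. z j)" by (simp only: z(2) restrict_apply' elem_sym_top)
  have "smult ((-1) ^ n * s n) (conj_rev n (signed_gen n s)) = signed_gen n s"
    unfolding P sn using z(1) s(2) by (intro self_inversive) (simp_all add: sn)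
  then have "coeff (smult ((-1) ^ n * s n) (conj_rev n (signed_gen n s))) k = coeff (signed_gen n s) k"
    by simp
  moreover have "k \<noteq> 0" "k \<le> n" "n - k \<noteq> 0" "n - k \<le> n" using k by auto
  ultimately have "((-1) ^ n * (-1) ^ (n - k)) * (s n * cnj (s (n - k))) = (-1) ^ k * s k"
    by (simp add: coeff_signed_gen coeff_conj_rev algebra_simps)
  then show ?thesis using neg_one_power_cancel[OF \<open>k \<le> n\<close>] by (simp add: mult.commute)
qed

text \<open>
  When \<open>\<bar>s\<^sub>n\<bar> = 1\<close> the linear equations for \<open>\<alpha>\<close> are degenerate. The choice made here
  turns the polynomial of \<open>\<alpha>\<close> into the normalised polar derivative of \<open>P\<close>. At a zero of the latter in
  the open disc, Laguerre's inequality would force \<open>P'\<close> and hence \<open>P\<close> to vanish as well.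
\<close>
lemma decomp_unimodular:
  assumes n: "n \<ge> 1" and s: "s \<in> sym_polydisc n" "cmod (s n) = 1"
  defines "\<alpha> \<equiv> \<lambda>i\<in>{1..n-1}. of_nat (n - i) / of_nat n * s i"
  shows "\<alpha> \<in> sym_polydisc (n - 1)"
    and "\<And>i. i \<in> {1..n-1} \<Longrightarrow> s i = \<alpha> i + cnj (\<alpha> (n - i)) * s n"
proof -
  have n0: "(of_nat n :: complex) \<noteq> 0" using n by simp
  have \<alpha>: "\<alpha> i = of_nat (n - i) / of_nat n * s i" if "i \<in> {1..n-1}" for i
    unfolding \<alpha>_def using that by (rule restrict_apply')
  obtain z where z: "z \<in> closed_polydisc n" "signed_gen n s = (\<Prod>j\<in>{1..n}. [:1, - z j:])"
    using s(1) sym_polydisc_iff_factors[OF sym_polydisc_extensional[OF s(1)]] by blast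
  have A: "smult (of_nat n) (signed_gen (n - 1) \<alpha>) = polar n (signed_gen n s)"
  proof (rule poly_eqI)
    fix k
    show "coeff (smult (of_nat n) (signed_gen (n - 1) \<alpha>)) k = coeff (polar n (signed_gen n s)) k"
      using n n0 \<alpha>[of k] by (auto simp: coeff_polar coeff_signed_gen of_nat_diff)
  qed
  show "\<alpha> \<in> sym_polydisc (n - 1)"
  proof (subst sym_polydisc_iff_zero_free, goal_cases)
    case 1
    show ?case by (simp add: \<alpha>_def)
  next
    case 2
    show ?case
    proof (intro allI impI notI)
      fix x assume x: "cmod x < 1" and "poly (signed_gen (n - 1) \<alpha>) x = 0"
      then have polar0: "poly (polar n (signed_gen n s)) x = 0"
        by (simp flip: A)
      then have "poly (pderiv (signed_gen n s)) x = 0"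
        using pderiv_le_polar[OF z(1) x] unfolding z(2)[symmetric] by simp
      with polar0 n0 have "poly (signed_gen n s) x = 0" by (simp add: poly_polar)
      with poly_prod_linear_nonzero[OF z(1) x] show False unfolding z(2) by simp
    qed
  qed
  fix i assume i: "i \<in> {1..n-1}"
  then have i': "n - i \<in> {1..n-1}" and ii: "n - (n - i) = i" by auto
  have "of_nat (n - i) + of_nat i = (of_nat n :: complex)"
    using i by (subst of_nat_add [symmetric], subst le_add_diff_inverse2) auto
  moreover have "\<alpha> i + cnj (\<alpha> (n - i)) * s n =
      of_nat (n - i) / of_nat n * s i + of_nat i / of_nat n * (cnj (s (n - i)) * s n)"
    using i by (simp add: \<alpha>[OF i] \<alpha>[OF i'] ii)
  ultimately show "s i = \<alpha> i + cnj (\<alpha> (n - i)) * s n"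
    unfolding reciprocal_coeffs[OF s i, symmetric] using n0 by (simp add: add_divide_distrib [symmetric] distrib_right [symmetric])
qed

text \<open>
  When \<open>\<bar>s\<^sub>n\<bar> < 1\<close>, the equations for the indices \<open>i\<close> and \<open>n - i\<close> form a regular linear system for
  \<open>\<alpha>\<^sub>i\<close> and the conjugate of \<open>\<alpha>\<^sub>n\<^sub>-\<^sub>i\<close>; the \<open>\<alpha>\<close> below is its solution.
\<close>
lemma decomp_strict:
  assumes n: "n \<ge> 1" and s: "s \<in> sym_polydisc n" "cmod (s n) < 1"
  defines "\<alpha> \<equiv> \<lambda>i\<in>{1..n-1}. (s i - cnj (s (n - i)) * s n) / (1 - s n * cnj (s n))"
  shows "\<alpha> \<in> sym_polydisc (n - 1)"
    and "\<And>i. i \<in> {1..n-1} \<Longrightarrow> s i = \<alpha> i + cnj (\<alpha> (n - i)) * s n"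
proof -
  define D where "D = 1 - s n * cnj (s n)"
  have "(cmod (s n))\<^sup>2 < 1" using s(2) by (simp add: power_less_one_iff)
  moreover have "D = of_real (1 - (cmod (s n))\<^sup>2)"
    unfolding D_def complex_norm_square[symmetric] by simp
  ultimately have D0: "D \<noteq> 0" by (simp only: of_real_eq_0_iff)
  have cnjD: "cnj D = D" by (simp add: D_def mult.commute)
  have \<alpha>: "\<alpha> i = (s i - cnj (s (n - i)) * s n) / D" if "i \<in> {1..n-1}" for i
    unfolding \<alpha>_def D_def using that by (rule restrict_apply')
  obtain z where z: "z \<in> closed_polydisc n" "signed_gen n s = (\<Prod>j\<in>{1..n}. [:1, - z j:])"
    using s(1) sym_polydisc_iff_factors[OF sym_polydisc_extensional[OF s(1)]] by blast
  have A: "smult D (signed_gen (n - 1) \<alpha>) =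
      signed_gen n s + smult (- ((-1) ^ n * s n)) (conj_rev n (signed_gen n s))"
  proof (rule poly_eqI)
    fix k
    consider "k = 0" | "k = n" "k \<noteq> 0" | "k > n" | "k \<in> {1..n-1}" by force
    then show "coeff (smult D (signed_gen (n - 1) \<alpha>)) k =
      coeff (signed_gen n s + smult (- ((-1) ^ n * s n)) (conj_rev n (signed_gen n s))) k"
    proof cases
      case 1
      have "(-1::complex) ^ n * (-1) ^ n = 1" by (simp flip: power_mult_distrib)
      then have "(-1) ^ n * s n * ((-1) ^ n * cnj (s n)) = s n * cnj (s n)"
        by (metis (no_types, lifting) mult.assoc mult.left_commute mult_1)
      with 1 n show ?thesis by (simp add: coeff_signed_gen coeff_conj_rev D_def)
    next
      case 4
      then have k: "k \<noteq> 0" "k \<le> n - 1" "k \<le> n" "n - k \<noteq> 0" "n - k \<le> n" by auto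
      have "(-1) ^ n * s n * ((-1) ^ (n - k) * cnj (s (n - k))) =
          ((-1) ^ n * (-1) ^ (n - k)) * (s n * cnj (s (n - k)))"
        by (simp only: mult_ac)
      also have "\<dots> = (-1) ^ k * (s n * cnj (s (n - k)))"
        using neg_one_power_cancel[OF k(3)] by simp
      finally show ?thesis using k D0
        by (simp add: coeff_signed_gen coeff_conj_rev \<alpha>[OF 4] algebra_simps)
    qed (use n in \<open>auto simp: coeff_signed_gen coeff_conj_rev\<close>)
  qed
  show "\<alpha> \<in> sym_polydisc (n - 1)"
  proof (subst sym_polydisc_iff_zero_free, goal_cases)
    case 1
    show ?case by (simp add: \<alpha>_def)
  next
    case 2
    show ?case
    proof (intro allI impI notI)
      fix x assume x: "cmod x < 1" and 0: "poly (signed_gen (n - 1) \<alpha>) x = 0"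
      have "poly (signed_gen n s) x + (- ((-1) ^ n * s n)) * poly (conj_rev n (signed_gen n s)) x \<noteq> 0"
      proof (rule add_dominated_nonzero)
        show "poly (signed_gen n s) x \<noteq> 0"
          unfolding z(2) using z(1) x by (rule poly_prod_linear_nonzero)
        show "cmod (poly (conj_rev n (signed_gen n s)) x) \<le> cmod (poly (signed_gen n s) x)"
          unfolding z(2) using z(1) x by (intro conj_rev_le) auto
        show "cmod (- ((-1) ^ n * s n)) < 1"
          using s(2) by (simp add: norm_mult norm_power)
      qed
      moreover have "D * poly (signed_gen (n - 1) \<alpha>) x =
          poly (signed_gen n s) x + (- ((-1) ^ n * s n)) * poly (conj_rev n (signed_gen n s)) x"
        using arg_cong[OF A, of "\<lambda>q. poly q x"] by (simp only: poly_add poly_smult)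
      ultimately show False using 0 by simp
    qed
  qed
  fix i assume i: "i \<in> {1..n-1}"
  then have i': "n - i \<in> {1..n-1}" and ii: "n - (n - i) = i" by auto
  have "\<alpha> i + cnj (\<alpha> (n - i)) * s n =
      ((s i - cnj (s (n - i)) * s n) + (cnj (s (n - i)) - s i * cnj (s n)) * s n) / D"
    by (simp add: \<alpha>[OF i] \<alpha>[OF i'] ii cnjD add_divide_distrib)
  also have "\<dots> = (s i * D) / D" by (simp add: D_def algebra_simps)
  finally show "s i = \<alpha> i + cnj (\<alpha> (n - i)) * s n" using D0 by simp
qed

lemma sym_polydisc_iff_decomp:
  assumes n: "n \<ge> 1" and s: "s \<in> {1..n} \<rightarrow>\<^sub>E UNIV"
  shows "s \<in> sym_polydisc n \<longleftrightarrow> cmod (s n) \<le> 1 \<and>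
    (\<exists>\<alpha>\<in>sym_polydisc (n - 1). \<forall>i\<in>{1..n-1}. s i = \<alpha> i + cnj (\<alpha> (n - i)) * s n)"
    (is "_ \<longleftrightarrow> _ \<and> ?decomp")
proof (intro iffI conjI)
  assume mem: "s \<in> sym_polydisc n"
  then show le: "cmod (s n) \<le> 1" using n by (intro sym_polydisc_last_le) auto
  show ?decomp
  proof (cases "cmod (s n) = 1")
    case True
    from decomp_unimodular[OF n mem True] show ?thesis by blast
  next
    case False
    with le have "cmod (s n) < 1" by simp
    from decomp_strict[OF n mem this] show ?thesis by blast
  qed
next
  assume "cmod (s n) \<le> 1 \<and> ?decomp"
  then show "s \<in> sym_polydisc n" using sym_polydisc_if_decomp[OF n s] by blast
qed

section \<open>Extraction of roots\<close>

lemma elem_sym_cong: "(\<And>j. j \<in> {1..d} \<Longrightarrow> z j = w j) \<Longrightarrow> elem_sym d i z = elem_sym d i w"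
  unfolding elem_sym_def by (intro sum.cong prod.cong refl) auto

text \<open>
  With \<open>k = m div p\<close>, both \<open>Z\<^sup>k\<close> and \<open>t\<close> are \<open>p\<close>-th roots of \<open>t\<^sup>p\<close>, so their quotient is a \<open>p\<close>-th root
  of unity; any \<open>k\<close>-th root of that quotient is an \<open>m\<close>-th root of unity.
\<close>
lemma root_of_unity_correction:
  fixes Z t :: complex
  assumes "m > 0" "p dvd m" "Z ^ m = t ^ p"
  obtains \<eta> where "\<eta> ^ m = 1" "(\<eta> * Z) ^ (m div p) = t"
proof -
  define k where "k = m div p"
  have k: "m = k * p" "k > 0" "p > 0"
    using assms(1,2) by (auto simp: k_def elim!: dvdE)
  have Z0: "Z = 0 \<longleftrightarrow> t = 0"
    using arg_cong[OF assms(3), of "\<lambda>u. u = 0"] assms(1) k(3) by simp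
  show ?thesis
  proof (cases "t = 0")
    case True
    then have "(1 * Z) ^ (m div p) = t" using Z0 k(2) unfolding k_def by (simp add: zero_power)
    then show ?thesis by (intro that[of 1]) simp_all
  next
    case False
    then have Z: "Z \<noteq> 0" using Z0 by simp
    have "k \<noteq> 0" using k(2) by simp
    then obtain \<eta> where \<eta>: "t / Z ^ k = \<eta> ^ k" by (rule exists_complex_root)
    have "u ^ m = (u ^ k) ^ p" for u :: complex
      unfolding k(1) by (rule power_mult)
    then have "\<eta> ^ m = t ^ p / Z ^ m"
      by (simp only: \<eta> [symmetric] power_divide)
    also have "\<dots> = 1" using assms(3) Z False by simp
    finally have "\<eta> ^ m = 1" .
    moreover have "(\<eta> * Z) ^ (m div p) = t"
      unfolding k_def [symmetric] using Z by (simp add: power_mult_distrib \<eta> [symmetric])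
    ultimately show ?thesis by (rule that)
  qed
qed

text \<open>
  Taking \<open>m\<close>-th roots of the parameters of a point of \<open>\<Gamma>\<^sub>n\<close> determines \<open>(z\<^sub>1 \<dots> z\<^sub>n)\<^bsup>m/p\<^esup>\<close> only up
  to a \<open>p\<close>-th root of unity. Multiplying \<open>z\<^sub>1\<close> by an \<open>m\<close>-th root of unity leaves \<open>z\<^sub>1\<^sup>m\<close> unchanged and
  repairs the product.
\<close>
lemma closed_Theta_iff_sym_polydisc:
  assumes m: "m > 0" and p: "p dvd m" and n: "n \<ge> 1" and \<theta>: "\<theta> \<in> {1..n} \<rightarrow>\<^sub>E UNIV"
  shows "\<theta> \<in> closed_Theta m p n \<longleftrightarrow> \<theta>(n := \<theta> n ^ p) \<in> sym_polydisc n"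
proof
  assume "\<theta> \<in> closed_Theta m p n"
  then obtain z where z: "z \<in> closed_polydisc n"
    and \<theta>z: "\<theta> = (\<lambda>i\<in>{1..n}. if i = n then (\<Prod>j\<in>{1..n}. z j) ^ (m div p)
      else elem_sym n i (\<lambda>j. z j ^ m))"
    unfolding closed_Theta_def by blast
  define w where "w = (\<lambda>j\<in>{1..n}. z j ^ m)"
  have "w \<in> closed_polydisc n"
    using z by (auto simp: w_def closed_polydisc_def PiE_iff norm_power power_le_one)
  moreover have "\<theta>(n := \<theta> n ^ p) = (\<lambda>i\<in>{1..n}. elem_sym n i w)"
  proof
    fix i
    have e: "elem_sym n i w = elem_sym n i (\<lambda>j. z j ^ m)"
      by (rule elem_sym_cong) (simp add: w_def)
    show "(\<theta>(n := \<theta> n ^ p)) i = (\<lambda>i\<in>{1..n}. elem_sym n i w) i"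
    proof (cases "i = n")
      case True
      have "\<theta> n ^ p = (\<Prod>j\<in>{1..n}. z j) ^ m"
        using n p by (simp add: \<theta>z flip: power_mult)
      also have "\<dots> = (\<Prod>j\<in>{1..n}. w j)"
        by (simp add: w_def prod_power_distrib)
      finally show ?thesis using True n by (simp add: elem_sym_top)
    next
      case False
      then show ?thesis by (simp add: e \<theta>z)
    qed
  qed
  ultimately show "\<theta>(n := \<theta> n ^ p) \<in> sym_polydisc n" unfolding sym_polydisc_def by blast
next
  assume "\<theta>(n := \<theta> n ^ p) \<in> sym_polydisc n"
  then obtain w where w: "w \<in> closed_polydisc n"
    and \<theta>w: "\<theta>(n := \<theta> n ^ p) = (\<lambda>i\<in>{1..n}. elem_sym n i w)"
    unfolding sym_polydisc_def by blast
  have "\<forall>j. \<exists>y. y ^ m = w j"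
  proof
    fix j
    show "\<exists>y. y ^ m = w j" using m by (metis exists_complex_root neq0_conv)
  qed
  then obtain y where y: "\<And>j. y j ^ m = w j" by metis
  have "(\<Prod>j\<in>{1..n}. y j) ^ m = \<theta> n ^ p"
    using fun_cong[OF \<theta>w, of n] n by (simp add: y elem_sym_top prod_power_distrib)
  then obtain \<eta> where \<eta>: "\<eta> ^ m = 1" "(\<eta> * (\<Prod>j\<in>{1..n}. y j)) ^ (m div p) = \<theta> n"
    using root_of_unity_correction[OF m p] by metis
  define z where "z = (\<lambda>j\<in>{1..n}. if j = 1 then \<eta> * y j else y j)"
  have zm: "z j ^ m = w j" if "j \<in> {1..n}" for j
    using that by (simp add: z_def power_mult_distrib \<eta> y)
  have "cmod (z j) \<le> 1" if j: "j \<in> {1..n}" for j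
  proof -
    have "cmod (z j) ^ m \<le> 1"
      using w j by (auto simp: zm closed_polydisc_def PiE_iff simp flip: norm_power)
    then show ?thesis using m by (simp add: power_le_one_iff)
  qed
  then have "z \<in> closed_polydisc n"
    by (auto simp: closed_polydisc_def z_def)
  moreover have "\<theta> = (\<lambda>i\<in>{1..n}. if i = n then (\<Prod>j\<in>{1..n}. z j) ^ (m div p)
      else elem_sym n i (\<lambda>j. z j ^ m))"
  proof
    fix i
    have "(\<Prod>j\<in>{1..n}. z j) = (\<Prod>j\<in>{1..n}. (if j = 1 then \<eta> else 1) * y j)"
      by (intro prod.cong) (auto simp: z_def)
    also have "\<dots> = \<eta> * (\<Prod>j\<in>{1..n}. y j)"
      using n by (simp add: prod.distrib)
    finally have prodz: "(\<Prod>j\<in>{1..n}. z j) ^ (m div p) = \<theta> n" using \<eta>(2) by simp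
    have e: "elem_sym n i (\<lambda>j. z j ^ m) = elem_sym n i w"
      by (rule elem_sym_cong) (rule zm)
    show "\<theta> i = (\<lambda>i\<in>{1..n}. if i = n then (\<Prod>j\<in>{1..n}. z j) ^ (m div p)
      else elem_sym n i (\<lambda>j. z j ^ m)) i"
      unfolding prodz using fun_cong[OF \<theta>w, of i] n
      by (auto simp: e simp del: One_nat_def split: if_splits)
  qed
  ultimately show "\<theta> \<in> closed_Theta m p n" unfolding closed_Theta_def by blast
qed

theorem theorem3p2:
  fixes m p n :: nat and \<theta> :: "nat \<Rightarrow> complex"
  assumes "m > 0" and "p > 0" and "p dvd m" and "n \<ge> 2"
    and "\<theta> \<in> {1..n} \<rightarrow>\<^sub>E UNIV"
  shows "(\<theta> \<in> closed_Theta m p n \<longleftrightarrow> \<theta>(n := \<theta> n ^ p) \<in> sym_polydisc n) \<and>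
    (\<theta>(n := \<theta> n ^ p) \<in> sym_polydisc n \<longleftrightarrow>
       (SUP z\<in>cball 0 1. rat_fun_norm (f_rat p n \<theta>) z) \<le> 1) \<and>
    ((SUP z\<in>cball 0 1. rat_fun_norm (f_rat p n \<theta>) z) \<le> 1 \<longleftrightarrow>
       cmod (\<theta> n) \<le> 1 \<and>
       (\<exists>\<alpha>\<in>sym_polydisc (n - 1). \<forall>i\<in>{1..n-1}.
          \<theta> i = \<alpha> i + cnj (\<alpha> (n - i)) * \<theta> n ^ p))"
proof -
  define s where "s = \<theta>(n := \<theta> n ^ p)"
  have n: "n \<ge> 1" using assms(4) by simp
  have s: "s \<in> {1..n} \<rightarrow>\<^sub>E UNIV"
    using assms(5) n by (auto simp: s_def PiE_iff extensional_def)
  have "\<theta> \<in> closed_Theta m p n \<longleftrightarrow> s \<in> sym_polydisc n"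
    unfolding s_def using assms(1,3) n assms(5) by (rule closed_Theta_iff_sym_polydisc)
  moreover have "s \<in> sym_polydisc n \<longleftrightarrow> (SUP z\<in>cball 0 1. rat_fun_norm (f_rat p n \<theta>) z) \<le> 1"
    unfolding f_rat_def numer_poly_eq_pderiv[OF n] denom_poly_eq_polar[OF n, of \<theta> p]
      s_def[symmetric] sym_polydisc_iff_zero_free[OF s]
    by (rule zero_free_iff_quotient_bounded[OF n degree_signed_gen poly_signed_gen_0])
  moreover have "s \<in> sym_polydisc n \<longleftrightarrow> cmod (\<theta> n) \<le> 1 \<and>
      (\<exists>\<alpha>\<in>sym_polydisc (n - 1). \<forall>i\<in>{1..n-1}.
          \<theta> i = \<alpha> i + cnj (\<alpha> (n - i)) * \<theta> n ^ p)"
  proof -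
    have "cmod (s n) \<le> 1 \<longleftrightarrow> cmod (\<theta> n) \<le> 1"
      using assms(2) by (simp add: s_def norm_power power_le_one_iff)
    moreover have "s i = \<theta> i" if "i \<in> {1..n-1}" for i
      using that by (auto simp: s_def)
    moreover have "s n = \<theta> n ^ p" by (simp add: s_def)
    ultimately show ?thesis using sym_polydisc_iff_decomp[OF n s] by simp
  qed
  ultimately show ?thesis unfolding s_def by blast
qed

end
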